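(* If $E(\lambda)$ is a Hermitian $n\times n$ matrix pencil with $\operatorname{rank}E=r\leq n$, then it can be written as $$E(\lambda)=(a_1+\lambda b_1)u_1u_1^*+\cdots+(a_\ell+\lambda b_\ell)u_\ell u_\ell^*+v_1w_1^*+\cdots+v_sw_s^*+w_1v_1^*+\cdots+w_sv_s^*,$$ where $a_i,b_i\in\mathbb R$ for $i=1,\dots,\ell$, $u_i,v_j,w_j\in\mathbb C[\lambda]^n$, and (i) $\ell+2s=r$; (ii) $\deg u_1=\cdots=\deg u_\ell=0=\deg v_1=\cdots=\deg v_s$ and $\deg w_1,\dots,\deg w_s\leq 1$.
   Context: A matrix pencil $E(\lambda)=A+\lambda B$ with $A,B\in\mathbb C^{n\times n}$ is Hermitian if $A=A^*$ and $B=B^*$. Its rank is the normal rank, i.e. the rank as a matrix over the field of rational functions, $\max_{\lambda\in\mathbb C}\operatorname{rank}(A+\lambda B)$. For $v(\lambda)\in\mathbb C[\lambda]^n$, $\deg v$ is the largest degree of the entries of $v$; so $\deg v=0$ means that $v$ is a constant vector in $\mathbb C^n$. For $w(\lambda)=w_0+\lambda w_1$ with $w_0,w_1\in\mathbb C^n$, $w^*$ denotes $w_0^*+\lambda w_1^*$ (conjugate transpose is applied to coefficients only, not to $\lambda$). *)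

theory Defs
  imports
    "HOL-Analysis.Analysis"
    "HOL-Computational_Algebra.Computational_Algebra"
begin

definition hermitian :: "complex^'n^'n \<Rightarrow> bool" where
  "hermitian A \<longleftrightarrow> map_matrix cnj (transpose A) = A"

text \<open>The pencil \<open>A + \<lambda> B\<close>, as a matrix over the ring of complex polynomials in \<open>\<lambda>\<close>.\<close>

definition pencil :: "complex^'n^'m \<Rightarrow> complex^'n^'m \<Rightarrow> complex poly^'n^'m" where
  "pencil A B = (\<chi> i j. [:A $ i $ j, B $ i $ j:])"

text \<open>The rank over the field of rational functions. The library's \<open>rank\<close> is only defined for
  matrices over a field, hence the passage to the fraction field.\<close>

definition normal_rank :: "complex poly^'n^'m \<Rightarrow> nat" where
  "normal_rank E = rank (map_matrix to_fract E)"

text \<open>The zero vector has degree 0, so degree 0 means constant.\<close>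

definition vec_degree :: "complex poly^'n \<Rightarrow> nat" where
  "vec_degree v = Max (range (\<lambda>i. degree (v $ i)))"

text \<open>The entries of the row vector \<open>w\<^sup>*\<close>: only the coefficients are conjugated, the
  indeterminate is left alone.\<close>

definition vec_star :: "complex poly^'n \<Rightarrow> complex poly^'n" where
  "vec_star w = (\<chi> i. map_poly cnj (w $ i))"

text \<open>Column vector times row vector.\<close>

definition outer_prod :: "'a::times^'m \<Rightarrow> 'a^'n \<Rightarrow> 'a^'n^'m" where
  "outer_prod x y = (\<chi> i j. x $ i * y $ j)"

definition matrix_scale :: "'a::times \<Rightarrow> 'a^'n^'m \<Rightarrow> 'a^'n^'m" where
  "matrix_scale c M = map_matrix ((*) c) M"

end

theory Submission
  imports Defs
begin

text \<open>Write \<open>\<langle>x, y\<rangle>\<close> for the standard Hermitian product on \<open>\<complex>\<^sup>n\<close> and call \<open>l + 2 s\<close> the weight of a sum of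
  \<open>l\<close> squares \<open>(a + \<lambda> b) u u\<^sup>*\<close> and \<open>s\<close> cross terms \<open>v w\<^sup>* + w v\<^sup>*\<close>. It is enough
  to find a sum of weight at most the normal rank, because squares of the zero vector fill up the
  weight. Two observations do the work.

  First, if \<open>W\<close> is a subspace of \<open>N\<close> with \<open>\<langle>x, A w\<rangle> = \<langle>x, B w\<rangle> = 0\<close> for \<open>x \<in> N\<close>, \<open>w \<in> W\<close>, then on
  \<open>N\<close> the pencil agrees with a sum of weight \<open>dim N - dim W\<close> (\<open>hermitian_sum_on_mod_radical\<close>). By
  the fundamental theorem of algebra there is a \<open>y \<in> N - W\<close> on which the functionals \<open>\<langle>x, A y\<rangle>\<close>
  and \<open>\<langle>x, B y\<rangle>\<close> of \<open>x \<in> N\<close> are proportional (\<open>pencil_eigenvector\<close>). If \<open>\<langle>y, A y\<rangle>\<close> or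
  \<open>\<langle>y, B y\<rangle>\<close> is nonzero, then subtracting one square makes \<open>y\<close> a member of the radical. If both
  vanish, then \<open>y\<close> lies in the radical of the restriction to a hyperplane of \<open>N\<close> (or of \<open>N\<close>
  itself), and a pencil that vanishes on a hyperplane is a single cross term
  (\<open>vanishes_on_hyperplane\<close>). In each case the weight spent is at most the drop of
  \<open>dim N - dim W\<close>. With \<open>N = \<complex>\<^sup>n\<close> and \<open>W = 0\<close> this is the theorem for pencils of full rank.

  Second, for a pencil of smaller rank, shift \<open>\<lambda>\<close> by a real number so that \<open>A\<close> has the largest
  rank among all \<open>A + t B\<close> with real \<open>t\<close>. Let \<open>W\<close> be the limit of the Wong sequence
  \<open>0, A\<inverse>(B 0), A\<inverse>(B (A\<inverse>(B 0))), \<dots>\<close>. Maximality of the rank gives \<open>B W \<subseteq> A W\<close> (\<open>wong_limit_in_range\<close>),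
  and then \<open>W\<close> is isotropic for both forms because \<open>A\<close> and \<open>B\<close> are Hermitian. With
  \<open>U = A W\<close> and \<open>N = U\<^sup>\<bottom>\<close> we have \<open>W \<subseteq> N\<close>, so the first observation yields weight
  \<open>dim N - dim W\<close> on \<open>N\<close>, and \<open>dim U\<close> cross terms extend this to \<open>\<complex>\<^sup>n\<close>. As \<open>W\<close> contains \<open>ker A\<close>, the
  total is \<open>dim N - dim W + 2 dim U = n - dim ker A = rank A\<close> (\<open>hermitian_sum_column_rank\<close>). The rank at one value of
  \<open>\<lambda>\<close> never exceeds the normal rank (\<open>column_rank_eval_le_normal_rank\<close>), which finishes the proof.\<close>

section \<open>The Hermitian product\<close>

definition cdot :: "complex^'n \<Rightarrow> complex^'n \<Rightarrow> complex" where
  "cdot x y = (\<Sum>i\<in>UNIV. cnj (x $ i) * y $ i)"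

lemma cdot_add_left: "cdot (x + x') y = cdot x y + cdot x' y"
  by (simp add: cdot_def sum.distrib algebra_simps)

lemma cdot_add_right: "cdot x (y + y') = cdot x y + cdot x y'"
  by (simp add: cdot_def sum.distrib algebra_simps)

lemma cdot_diff_left: "cdot (x - x') y = cdot x y - cdot x' y"
  by (simp add: cdot_def sum_subtractf algebra_simps)

lemma cdot_diff_right: "cdot x (y - y') = cdot x y - cdot x y'"
  by (simp add: cdot_def sum_subtractf algebra_simps)

lemma cdot_scale_left: "cdot (c *s x) y = cnj c * cdot x y"
  by (simp add: cdot_def sum_distrib_left algebra_simps)

lemma cdot_scale_right: "cdot x (c *s y) = c * cdot x y"
  by (simp add: cdot_def sum_distrib_left algebra_simps)

lemma cdot_zero [simp]: "cdot 0 y = 0" "cdot x 0 = 0"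
  by (simp_all add: cdot_def)

lemma cdot_sum_right: "cdot x (sum f S) = (\<Sum>k\<in>S. cdot x (f k))"
  by (induction S rule: infinite_finite_induct) (simp_all add: cdot_add_right)

lemma cnj_cdot: "cnj (cdot x y) = cdot y x"
  by (simp add: cdot_def mult.commute)

lemma cdot_self_eq_0: "cdot x x = 0 \<longleftrightarrow> x = 0"
proof
  have "cnj a * a = of_real ((cmod a)\<^sup>2)" for a
    by (metis complex_norm_square mult.commute)
  then have "cdot x x = of_real (\<Sum>i\<in>UNIV. (cmod (x $ i))\<^sup>2)"
    by (simp add: cdot_def)
  moreover assume "cdot x x = 0"
  ultimately have "(\<Sum>i\<in>UNIV. (cmod (x $ i))\<^sup>2) = 0"
    by (metis of_real_eq_0_iff)
  then show "x = 0"
    by (simp add: sum_nonneg_eq_0_iff vec_eq_iff)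
qed simp

lemmas cdot_simps = cdot_add_left cdot_add_right cdot_diff_left cdot_diff_right
  cdot_scale_left cdot_scale_right

lemma hermitian_iff_entry: "hermitian A \<longleftrightarrow> (\<forall>i j. cnj (A $ i $ j) = A $ j $ i)"
  unfolding hermitian_def by (auto simp: vec_eq_iff transpose_def)

lemmas hermitian_entry = hermitian_iff_entry[THEN iffD1, rule_format]

lemma cdot_hermitian:
  assumes "hermitian A"
  shows "cdot (A *v x) y = cdot x (A *v y)"
proof -
  have "cdot (A *v x) y = (\<Sum>i\<in>UNIV. \<Sum>j\<in>UNIV. A $ j $ i * cnj (x $ j) * y $ i)"
    by (simp add: cdot_def matrix_vector_mult_def sum_distrib_right hermitian_entry[OF assms])
  also have "\<dots> = (\<Sum>j\<in>UNIV. \<Sum>i\<in>UNIV. A $ j $ i * cnj (x $ j) * y $ i)"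
    by (rule sum.swap)
  also have "\<dots> = cdot x (A *v y)"
    by (simp add: cdot_def matrix_vector_mult_def sum_distrib_left algebra_simps)
  finally show ?thesis .
qed

text \<open>The orthogonal projection for the real inner product works: a complex subspace is closed under
  multiplication by \<open>\<i>\<close>, so real orthogonality to it also kills the imaginary part.\<close>
lemma perp_decomposition:
  fixes S :: "(complex^'n) set"
  assumes S: "vec.subspace S"
  obtains a where "a \<in> S" "\<And>s. s \<in> S \<Longrightarrow> cdot s (x - a) = 0"
proof -
  have "subspace S"
    using vec.subspace_0[OF S] vec.subspace_add[OF S] vec.subspace_scale[OF S, of _ "complex_of_real _"]
    by (auto simp: subspace_def scaleR_vec_def scaleR_conv_of_real vector_scalar_mult_def)
  then have spanS: "span S = S"
    by simp
  obtain a z where az: "a \<in> S" "\<And>w. w \<in> S \<Longrightarrow> orthogonal z w" "x = a + z"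
    using orthogonal_subspace_decomp_exists[of S x] unfolding spanS by metis
  have Re: "Re (cdot s z) = 0" if "s \<in> S" for s
  proof -
    have "z \<bullet> s = Re (cdot s z)"
      by (simp add: inner_vec_def cdot_def inner_complex_def mult.commute)
    then show ?thesis
      using az(2)[OF that] by (simp add: orthogonal_def)
  qed
  have "cdot s z = 0" if "s \<in> S" for s
  proof -
    have "Re (cdot (\<i> *s s) z) = 0"
      by (rule Re) (rule vec.subspace_scale[OF S that])
    then have "Im (cdot s z) = 0"
      by (simp add: cdot_scale_left)
    with Re[OF that] show ?thesis
      by (simp add: complex_eq_iff)
  qed
  then show thesis
    using that[of a] az by simp
qed

lemma double_perp:
  assumes S: "vec.subspace S"
    and y: "\<And>x. (\<And>s. s \<in> S \<Longrightarrow> cdot s x = 0) \<Longrightarrow> cdot x y = 0"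
  shows "y \<in> S"
proof -
  obtain a where a: "a \<in> S" "\<And>s. s \<in> S \<Longrightarrow> cdot s (y - a) = 0"
    using perp_decomposition[OF S] by metis
  have "cdot (y - a) y = 0"
    using y a(2) by blast
  moreover have "cdot (y - a) a = 0"
    using a cnj_cdot[of a "y - a"] by simp
  ultimately have "cdot (y - a) (y - a) = 0"
    by (simp add: cdot_diff_right)
  then show ?thesis
    using a(1) by (simp add: cdot_self_eq_0)
qed

text \<open>The Fredholm alternative for the form of \<open>B\<close> restricted to \<open>N\<close>: the sum of \<open>B N\<close> and the
  orthogonal complement of \<open>N\<close> is the orthogonal complement of the radical of that restriction.\<close>
lemma solvable_if_perp_radical:
  fixes B :: "complex^'n^'n"
  assumes N: "vec.subspace N" and B: "hermitian B"
    and Y: "\<And>x. x \<in> N \<Longrightarrow> (\<And>n. n \<in> N \<Longrightarrow> cdot n (B *v x) = 0) \<Longrightarrow> cdot x Y = 0"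
  obtains b where "b \<in> N" "\<And>x. x \<in> N \<Longrightarrow> cdot x (B *v b) = cdot x Y"
proof -
  define P where "P = {p. \<forall>n\<in>N. cdot n p = 0}"
  define S where "S = {x + p |x p. x \<in> ((*v) B) ` N \<and> p \<in> P}"
  have P: "vec.subspace P"
    unfolding P_def by (auto simp: vec.subspace_def cdot_simps)
  have BN: "vec.subspace (((*v) B) ` N)"
    by (rule vec.subspace_image) (rule N)
  have S: "vec.subspace S"
    unfolding S_def by (rule vec.subspace_sums[OF BN P])
  have "Y \<in> S"
  proof (rule double_perp[OF S])
    fix x assume x: "\<And>s. s \<in> S \<Longrightarrow> cdot s x = 0"
    have 1: "cdot (B *v n) x = 0" if "n \<in> N" for n
      using x[of "B *v n + 0"] that vec.subspace_0[OF P] unfolding S_def by fastforce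
    have 2: "cdot p x = 0" if "p \<in> P" for p
      using x[of "B *v 0 + p"] that vec.subspace_0[OF N] unfolding S_def by fastforce
    have "x \<in> N"
      by (rule double_perp[OF N]) (use 2 in \<open>auto simp: P_def\<close>)
    moreover have "cdot n (B *v x) = 0" if "n \<in> N" for n
      using 1[OF that] by (simp add: cdot_hermitian[OF B])
    ultimately show "cdot x Y = 0"
      by (rule Y)
  qed
  then obtain b p where "b \<in> N" "p \<in> P" "Y = B *v b + p"
    unfolding S_def by auto
  then show thesis
    using that[of b] by (auto simp: P_def cdot_add_right)
qed

section \<open>Eigenvectors of a Hermitian pencil\<close>

lemma polynomial_relation:
  fixes y :: "nat \<Rightarrow> complex^'n"
  obtains p where "p \<noteq> 0" "(\<Sum>k\<le>degree p. coeff p k *s y k) = 0"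
proof -
  define n where "n = CARD('n)"
  obtain p where p: "p \<noteq> 0" "degree p \<le> n" "(\<Sum>k\<le>n. coeff p k *s y k) = 0"
  proof (cases "inj_on y {..n}")
    case False
    then obtain i j where ij: "i \<le> n" "j \<le> n" "i \<noteq> j" "y i = y j"
      by (auto simp: inj_on_def)
    define p :: "complex poly" where "p = monom 1 i - monom 1 j"
    have co: "coeff p k = (if k = i then 1 else 0) - (if k = j then 1 else 0)" for k
      by (auto simp: p_def)
    have "coeff p i \<noteq> 0"
      using ij by (simp add: co)
    then have "p \<noteq> 0"
      by auto
    moreover have "degree p \<le> n"
      unfolding p_def by (rule degree_diff_le) (use ij in \<open>simp_all add: degree_monom_eq\<close>)
    moreover have "(\<Sum>k\<le>n. coeff p k *s y k) =
        (\<Sum>k\<le>n. if k = i then y k else 0) - (\<Sum>k\<le>n. if k = j then y k else 0)"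
      unfolding sum_subtractf[symmetric] by (rule sum.cong) (auto simp: co)
    then have "(\<Sum>k\<le>n. coeff p k *s y k) = 0"
      using ij by simp
    ultimately show thesis
      using that by blast
  next
    case True
    have "card (y ` {..n}) > vec.dim (UNIV :: (complex^'n) set)"
      unfolding vec_dim_card card_image[OF True] by (simp add: n_def)
    then have "vec.dependent (y ` {..n})"
      using vec.independent_card_le_dim[of "y ` {..n}" UNIV] by auto
    then obtain c where c: "(\<Sum>v\<in>y ` {..n}. c v *s v) = 0" "\<exists>v\<in>y ` {..n}. c v \<noteq> 0"
      unfolding vec.dependent_finite[OF finite_imageI[OF finite_atMost]] by blast
    define p where "p = (\<Sum>k\<le>n. monom (c (y k)) k)"
    have co: "coeff p k = c (y k)" if "k \<le> n" for k
      using that by (simp add: p_def coeff_sum)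
    obtain k where k: "k \<le> n" "c (y k) \<noteq> 0"
      using c(2) by auto
    then have "p \<noteq> 0"
      using co[of k] by auto
    moreover have "degree p \<le> n"
      unfolding p_def by (rule degree_sum_le) (simp_all add: order.trans[OF degree_monom_le])
    moreover have "(\<Sum>k\<le>n. coeff p k *s y k) = 0"
      using c(1) co by (simp add: sum.reindex[OF True])
    ultimately show thesis
      using that by blast
  qed
  have "(\<Sum>k\<le>degree p. coeff p k *s y k) = (\<Sum>k\<le>n. coeff p k *s y k)"
    by (rule sum.mono_neutral_left) (use p in \<open>auto simp: coeff_eq_0\<close>)
  then show thesis
    using that[of p] p by simp
qed

text \<open>An eigenvector of the pencil that \<open>A\<close> and \<open>B\<close> induce on \<open>N/W\<close>, with \<open>(\<alpha>, \<beta>)\<close> as homogeneous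
  eigenvalue. If the form of \<open>B\<close> is degenerate on \<open>N/W\<close>, any vector of its radical serves, with
  eigenvalue infinity. Otherwise the equation \<open>B y' = A y\<close>, read as an equation of functionals on
  \<open>N\<close>, can be solved again and again; the resulting sequence satisfies a polynomial relation modulo
  \<open>W\<close>, and splitting a linear factor off a relation of least degree gives the eigenvector.\<close>
lemma pencil_eigenvector:
  fixes A B :: "complex^'n^'n"
  assumes A: "hermitian A" and B: "hermitian B"
    and N: "vec.subspace N" and W: "vec.subspace W" and "W \<subset> N"
    and radA: "\<And>x w. x \<in> N \<Longrightarrow> w \<in> W \<Longrightarrow> cdot x (A *v w) = 0"
    and radB: "\<And>x w. x \<in> N \<Longrightarrow> w \<in> W \<Longrightarrow> cdot x (B *v w) = 0"
  obtains y \<alpha> \<beta> where "y \<in> N" "y \<notin> W" "\<alpha> \<noteq> 0 \<or> \<beta> \<noteq> 0"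
    "\<And>x. x \<in> N \<Longrightarrow> \<beta> * cdot x (A *v y) = \<alpha> * cdot x (B *v y)"
proof (cases "\<exists>y\<in>N - W. \<forall>x\<in>N. cdot x (B *v y) = 0")
  case True
  then show thesis
    using that[of _ 1 0] by auto
next
  case False
  have "\<exists>b\<in>N. \<forall>x\<in>N. cdot x (B *v b) = cdot x (A *v y)" if yN: "y \<in> N" for y
  proof -
    obtain b where "b \<in> N" "\<And>x. x \<in> N \<Longrightarrow> cdot x (B *v b) = cdot x (A *v y)"
    proof (rule solvable_if_perp_radical[OF N B])
      fix x assume "x \<in> N" "\<And>n. n \<in> N \<Longrightarrow> cdot n (B *v x) = 0"
      then have "x \<in> W"
        using False by auto
      then have "cdot y (A *v x) = 0"
        using radA yN by simp
      then show "cdot x (A *v y) = 0"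
        using cdot_hermitian[OF A, of x y] cnj_cdot[of y "A *v x"] by simp
    qed blast
    then show ?thesis by blast
  qed
  then obtain T where T: "\<And>y. y \<in> N \<Longrightarrow> T y \<in> N"
    "\<And>x y. y \<in> N \<Longrightarrow> x \<in> N \<Longrightarrow> cdot x (B *v T y) = cdot x (A *v y)"
    by metis
  obtain y0 where y0: "y0 \<in> N" "y0 \<notin> W"
    using \<open>W \<subset> N\<close> by blast
  define y where "y k = (T ^^ k) y0" for k
  have yN: "y k \<in> N" for k
    by (induction k) (auto simp: y_def y0 T)
  have yS: "cdot x (B *v y (Suc k)) = cdot x (A *v y k)" if "x \<in> N" for x k
    using T(2)[OF yN that] by (simp add: y_def)
  (* ev p stands for p(T) y0; T is a mere choice function, so the powers are taken along the sequence y *)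
  define ev where "ev p = (\<Sum>k\<le>degree p. coeff p k *s y k)" for p
  have ev_eq: "ev p = (\<Sum>k\<le>m. coeff p k *s y k)" if "degree p \<le> m" for p m
    unfolding ev_def by (rule sum.mono_neutral_left) (use that in \<open>auto simp: coeff_eq_0\<close>)
  define R where "R p \<longleftrightarrow> p \<noteq> 0 \<and> ev p \<in> W" for p
  obtain p1 where "R p1"
    using polynomial_relation[of y] vec.subspace_0[OF W] unfolding R_def ev_def by metis
  then obtain p where p: "R p" "\<And>q. R q \<Longrightarrow> degree p \<le> degree q"
    using ex_has_least_nat[of R p1 degree] by blast
  have "degree p \<noteq> 0"
  proof
    assume d: "degree p = 0"
    then have "coeff p 0 \<noteq> 0"
      using p(1) unfolding R_def by (metis leading_coeff_0_iff)
    moreover have "coeff p 0 *s y0 \<in> W"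
      using p(1) d by (simp add: R_def ev_def y_def)
    ultimately have "inverse (coeff p 0) *s (coeff p 0 *s y0) \<in> W"
      using vec.subspace_scale[OF W] by blast
    with y0 \<open>coeff p 0 \<noteq> 0\<close> show False by simp
  qed
  then obtain \<mu> where "poly p \<mu> = 0"
    using fundamental_theorem_of_algebra[of p] by (auto simp: constant_degree)
  then obtain q where q: "p = [:-\<mu>, 1:] * q"
    by (metis dvdE poly_eq_0_iff_dvd)
  have "q \<noteq> 0"
    using p(1) q unfolding R_def by auto
  then have deg: "degree p = Suc (degree q)"
    unfolding q by (subst degree_mult_eq) auto
  then have "\<not> R q"
    using p(2)[of q] by auto
  with \<open>q \<noteq> 0\<close> have "ev q \<notin> W"
    by (simp add: R_def)
  moreover have "ev q \<in> N"
    unfolding ev_def by (intro vec.subspace_sum[OF N] vec.subspace_scale[OF N] yN)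
  moreover have "cdot x (A *v ev q) = \<mu> * cdot x (B *v ev q)" if x: "x \<in> N" for x
  proof -
    let ?d = "degree q"
    have lin: "cdot x (M *v (\<Sum>k\<in>K. f k *s z k)) = (\<Sum>k\<in>K. f k * cdot x (M *v z k))"
      for M :: "complex^'n^'n" and K and f :: "nat \<Rightarrow> complex" and z :: "nat \<Rightarrow> complex^'n"
      by (simp add: vec.sum vec.scale cdot_sum_right cdot_scale_right)
    (* compare coefficients in p = (X - mu) q *)
    have "ev p = (\<Sum>k\<le>Suc ?d. coeff p k *s y k)"
      by (rule ev_eq) (simp add: deg)
    also have "\<dots> = (\<Sum>k\<le>Suc ?d. (case k of 0 \<Rightarrow> 0 | Suc i \<Rightarrow> coeff q i) *s y k)
        - \<mu> *s (\<Sum>k\<le>Suc ?d. coeff q k *s y k)"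
      unfolding vec.scale_sum_right sum_subtractf[symmetric]
      by (rule sum.cong) (auto simp: q coeff_pCons vec_eq_iff algebra_simps split: nat.splits)
    also have "(\<Sum>k\<le>Suc ?d. (case k of 0 \<Rightarrow> 0 | Suc i \<Rightarrow> coeff q i) *s y k)
        = (\<Sum>k\<le>?d. coeff q k *s y (Suc k))"
      by (subst sum.atMost_Suc_shift) simp
    also have "(\<Sum>k\<le>Suc ?d. coeff q k *s y k) = ev q"
      by (rule ev_eq[symmetric]) simp
    finally have evp: "ev p = (\<Sum>k\<le>?d. coeff q k *s y (Suc k)) - \<mu> *s ev q" .
    have "0 = cdot x (B *v ev p)"
      using radB x p(1) by (simp add: R_def)
    also have "\<dots> = (\<Sum>k\<le>?d. coeff q k * cdot x (B *v y (Suc k))) - \<mu> * cdot x (B *v ev q)"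
      by (simp add: evp vec.diff vec.scale cdot_diff_right cdot_scale_right lin)
    also have "(\<Sum>k\<le>?d. coeff q k * cdot x (B *v y (Suc k))) = cdot x (A *v ev q)"
      unfolding ev_def lin yS[OF x] ..
    finally show ?thesis by simp
  qed
  ultimately show thesis
    using that[of "ev q" \<mu> 1] by simp
qed


section \<open>Sums of Hermitian squares and cross terms\<close>

definition rank1 :: "complex^'n \<Rightarrow> complex^'n \<Rightarrow> complex^'n^'n" where
  "rank1 u w = outer_prod u (\<chi> j. cnj (w $ j))"

lemma rank1_entry [simp]: "rank1 u w $ i $ j = u $ i * cnj (w $ j)"
  by (simp add: rank1_def outer_prod_def)

lemma rank1_mult: "rank1 u w *v y = cdot w y *s u"
  by (simp add: vec_eq_iff matrix_vector_mult_def cdot_def sum_distrib_left algebra_simps)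

lemma scaleR_matrix_mult: "(a *\<^sub>R M) *v y = of_real a *s (M *v y)"
  by (simp add: vec_eq_iff matrix_vector_mult_def sum_distrib_left)
    (simp add: scaleR_conv_of_real mult.assoc)

lemma rank1_0 [simp]: "rank1 0 w = 0" "rank1 u 0 = 0"
  by (simp_all add: vec_eq_iff)

lemma hermitian_diff: "hermitian A \<Longrightarrow> hermitian B \<Longrightarrow> hermitian (A - B)"
  by (simp add: hermitian_iff_entry)

lemma hermitian_scaleR: "hermitian A \<Longrightarrow> hermitian (a *\<^sub>R A)"
  by (simp add: hermitian_iff_entry)

lemma hermitian_square: "hermitian (a *\<^sub>R rank1 u u)"
  by (rule hermitian_scaleR) (simp add: hermitian_iff_entry mult.commute)

lemma hermitian_cross: "hermitian (rank1 u w + rank1 w u)"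
  by (simp add: hermitian_iff_entry algebra_simps)

text \<open>Weight one for a square and two for a cross term makes the weight an upper bound for the rank.
  Building the sum term by term instead of from indexed families turns appending a term into a rule.\<close>
inductive hermitian_sum :: "complex^'n^'n \<Rightarrow> complex^'n^'n \<Rightarrow> nat \<Rightarrow> bool" where
  zero: "hermitian_sum 0 0 0"
| square: "hermitian_sum A B m \<Longrightarrow> hermitian_sum (A + a *\<^sub>R rank1 u u) (B + b *\<^sub>R rank1 u u) (Suc m)"
| cross: "hermitian_sum A B m \<Longrightarrow>
    hermitian_sum (A + (rank1 v w + rank1 w v)) (B + (rank1 v w' + rank1 w' v)) (m + 2)"

text \<open>The square of the zero vector raises the weight without changing the pencil.\<close>
lemma hermitian_sum_mono: "hermitian_sum A B m \<Longrightarrow> m \<le> m' \<Longrightarrow> hermitian_sum A B m'"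
proof (induction m' rule: nat_induct)
  case (Suc k)
  show ?case
  proof (cases "m = Suc k")
    case False
    then have "hermitian_sum (A + 0 *\<^sub>R rank1 0 0) (B + 0 *\<^sub>R rank1 0 0) (Suc k)"
      using Suc by (intro hermitian_sum.square) auto
    then show ?thesis by simp
  qed (use Suc in simp)
qed simp

definition vanishes_on :: "complex^'n^'n \<Rightarrow> (complex^'n) set \<Rightarrow> bool" where
  "vanishes_on A N \<longleftrightarrow> (\<forall>x\<in>N. \<forall>y\<in>N. cdot x (A *v y) = 0)"

text \<open>The pencil agrees with a sum of weight \<open>m\<close> as a form on \<open>N\<close>. The remainder is kept as a Hermitian
  pencil on the whole space, so that subspaces of different dimension need no change of type.\<close>
definition hermitian_sum_on :: "complex^'n^'n \<Rightarrow> complex^'n^'n \<Rightarrow> (complex^'n) set \<Rightarrow> nat \<Rightarrow> bool" where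
  "hermitian_sum_on A B N m \<longleftrightarrow> (\<exists>A' B'. hermitian A' \<and> hermitian B' \<and>
     vanishes_on A' N \<and> vanishes_on B' N \<and> hermitian_sum (A - A') (B - B') m)"

lemma hermitian_sum_on_mono: "hermitian_sum_on A B N m \<Longrightarrow> m \<le> m' \<Longrightarrow> hermitian_sum_on A B N m'"
  unfolding hermitian_sum_on_def using hermitian_sum_mono by blast

lemma hermitian_sum_on_square:
  assumes "hermitian_sum_on (A - a *\<^sub>R rank1 u u) (B - b *\<^sub>R rank1 u u) N m"
  shows "hermitian_sum_on A B N (Suc m)"
proof -
  obtain A' B' where *: "hermitian A'" "hermitian B'" "vanishes_on A' N" "vanishes_on B' N"
      "hermitian_sum (A - a *\<^sub>R rank1 u u - A') (B - b *\<^sub>R rank1 u u - B') m"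
    using assms unfolding hermitian_sum_on_def by blast
  have "hermitian_sum (A - a *\<^sub>R rank1 u u - A' + a *\<^sub>R rank1 u u)
      (B - b *\<^sub>R rank1 u u - B' + b *\<^sub>R rank1 u u) (Suc m)"
    using *(5) by (rule hermitian_sum.square)
  then have "hermitian_sum (A - A') (B - B') (Suc m)"
    by (simp add: algebra_simps)
  with * show ?thesis
    unfolding hermitian_sum_on_def by blast
qed

text \<open>Choose \<open>t \<in> N\<close> with \<open>\<langle>z, t\<rangle> = 1\<close>. Splitting vectors of \<open>N\<close> along \<open>t\<close> and the hyperplane expresses \<open>F\<close>
  through the functional \<open>\<langle>F t, _\<rangle>\<close> and the number \<open>\<langle>t, F t\<rangle>\<close>; the two halves of the cross term must
  share the latter, hence \<open>w = F t - (\<langle>t, F t\<rangle> / 2) z\<close>.\<close>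
lemma vanishes_on_hyperplane:
  fixes F :: "complex^'n^'n"
  assumes F: "hermitian F" and N: "vec.subspace N"
    and van: "vanishes_on F (N \<inter> {x. cdot z x = 0})"
  obtains w where "vanishes_on (F - (rank1 z w + rank1 w z)) N"
proof (cases "\<forall>t\<in>N. cdot z t = 0")
  case True
  then have "N \<inter> {x. cdot z x = 0} = N"
    by blast
  with van show thesis
    using that[of 0] by simp
next
  case False
  then obtain t0 where t0: "t0 \<in> N" "cdot z t0 \<noteq> 0"
    by blast
  define t where "t = inverse (cdot z t0) *s t0"
  have t: "t \<in> N" "cdot z t = 1"
    using t0 vec.subspace_scale[OF N] by (auto simp: t_def cdot_scale_right)
  define c where "c = cdot t (F *v t)"
  have c: "cnj c = c"
    unfolding c_def using cdot_hermitian[OF F, of t t] cnj_cdot[of t "F *v t"] by simp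
  define w where "w = F *v t - (c / 2) *s z"
  have "cdot x ((F - (rank1 z w + rank1 w z)) *v y) = 0" if x: "x \<in> N" and y: "y \<in> N" for x y
  proof -
    define \<xi> \<eta> where "\<xi> = cdot z x" and "\<eta> = cdot z y"
    have \<xi>: "cdot x z = cnj \<xi>"
      unfolding \<xi>_def by (simp add: cnj_cdot)
    have "x - \<xi> *s t \<in> N \<inter> {x. cdot z x = 0}" "y - \<eta> *s t \<in> N \<inter> {x. cdot z x = 0}"
      using t x y vec.subspace_diff[OF N] vec.subspace_scale[OF N]
      by (auto simp: cdot_simps \<xi>_def \<eta>_def)
    then have "cdot (x - \<xi> *s t) (F *v (y - \<eta> *s t)) = 0"
      using van by (simp add: vanishes_on_def)
    then have 0: "cdot x (F *v y) = cnj \<xi> * cdot t (F *v y) + \<eta> * cdot x (F *v t) - cnj \<xi> * \<eta> * c"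
      by (simp add: vec.diff vec.scale cdot_simps c_def algebra_simps)
    have "cdot w y = cdot t (F *v y) - c / 2 * \<eta>"
      by (simp add: w_def cdot_simps cdot_hermitian[OF F] c \<eta>_def)
    moreover have "cdot x w = cdot x (F *v t) - c / 2 * cnj \<xi>"
      by (simp add: w_def cdot_simps \<xi>)
    ultimately show ?thesis
      by (simp add: matrix_vector_mult_diff_rdistrib matrix_vector_mult_add_rdistrib rank1_mult
          cdot_simps 0 \<xi> \<eta>_def[symmetric]) (simp add: field_simps)
  qed
  then show thesis
    using that[of w] unfolding vanishes_on_def by blast
qed

text \<open>The same \<open>z\<close> serves \<open>A\<close> and \<open>B\<close>, so that one cross term with constant first vector repairs both.\<close>
lemma hermitian_sum_on_cross:
  assumes N: "vec.subspace N" and "hermitian_sum_on A B (N \<inter> {x. cdot z x = 0}) m"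
  shows "hermitian_sum_on A B N (m + 2)"
proof -
  obtain A' B' where *: "hermitian A'" "hermitian B'" "vanishes_on A' (N \<inter> {x. cdot z x = 0})"
      "vanishes_on B' (N \<inter> {x. cdot z x = 0})" "hermitian_sum (A - A') (B - B') m"
    using assms unfolding hermitian_sum_on_def by blast
  obtain w where w: "vanishes_on (A' - (rank1 z w + rank1 w z)) N"
    using vanishes_on_hyperplane[OF *(1) N *(3)] .
  obtain w' where w': "vanishes_on (B' - (rank1 z w' + rank1 w' z)) N"
    using vanishes_on_hyperplane[OF *(2) N *(4)] .
  have "hermitian_sum (A - A' + (rank1 z w + rank1 w z)) (B - B' + (rank1 z w' + rank1 w' z)) (m + 2)"
    using *(5) by (rule hermitian_sum.cross)
  then have "hermitian_sum (A - (A' - (rank1 z w + rank1 w z))) (B - (B' - (rank1 z w' + rank1 w' z))) (m + 2)"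
    by (simp add: algebra_simps)
  then show ?thesis
    unfolding hermitian_sum_on_def using w w' hermitian_diff[OF *(1) hermitian_cross]
      hermitian_diff[OF *(2) hermitian_cross] by blast
qed

lemma subspace_perp: "vec.subspace {x. \<forall>z\<in>Z. cdot z x = 0}"
  by (auto simp: vec.subspace_def cdot_simps)

lemma subspace_hyperplane: "vec.subspace {x. cdot z x = 0}"
  using subspace_perp[of "{z}"] by simp

lemma hermitian_sum_on_perp:
  assumes "finite Z" and "vec.subspace N" and "hermitian_sum_on A B (N \<inter> {x. \<forall>z\<in>Z. cdot z x = 0}) m"
  shows "hermitian_sum_on A B N (m + 2 * card Z)"
  using assms
proof (induction Z arbitrary: N rule: finite_induct)
  case (insert z Z)
  have "N \<inter> {x. \<forall>z\<in>insert z Z. cdot z x = 0} = (N \<inter> {x. cdot z x = 0}) \<inter> {x. \<forall>z\<in>Z. cdot z x = 0}"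
    by auto
  then have "hermitian_sum_on A B (N \<inter> {x. cdot z x = 0}) (m + 2 * card Z)"
    using insert.IH[of "N \<inter> {x. cdot z x = 0}"] insert.prems
    by (simp add: vec.subspace_inter subspace_hyperplane)
  then show ?case
    using hermitian_sum_on_cross[OF insert.prems(1)] insert.hyps by fastforce
qed simp

text \<open>Induction on \<open>dim N - dim W\<close>. An eigenvector \<open>y\<close> of the pencil on \<open>N/W\<close> is added to \<open>W\<close>, either
  after subtracting a square, which costs one, or after shrinking \<open>N\<close> by a hyperplane, which costs
  two but lowers \<open>dim N - dim W\<close> by two as well. If the functionals of \<open>y\<close> vanish on \<open>N\<close>, the step
  is free of cost.\<close>
lemma hermitian_sum_on_mod_radical:
  fixes A B :: "complex^'n^'n"
  assumes "hermitian A" "hermitian B" "vec.subspace N" "vec.subspace W" "W \<subseteq> N"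
    and "\<And>x w. x \<in> N \<Longrightarrow> w \<in> W \<Longrightarrow> cdot x (A *v w) = 0"
    and "\<And>x w. x \<in> N \<Longrightarrow> w \<in> W \<Longrightarrow> cdot x (B *v w) = 0"
  shows "hermitian_sum_on A B N (vec.dim N - vec.dim W)"
  using assms
proof (induction "vec.dim N - vec.dim W" arbitrary: A B N W rule: less_induct)
  case less
  note A = less.prems(1) and B = less.prems(2) and N = less.prems(3) and W = less.prems(4)
    and WN = less.prems(5) and radA = less.prems(6) and radB = less.prems(7)
  show ?case
  proof (cases "W = N")
    case True
    then show ?thesis
      unfolding hermitian_sum_on_def
      using A B radA radB hermitian_sum.zero by (intro exI[of _ A] exI[of _ B]) (simp add: vanishes_on_def)
  next
    case False
    with WN have "W \<subset> N" by blast
    obtain y \<alpha> \<beta> where y: "y \<in> N" "y \<notin> W" and \<alpha>\<beta>: "\<alpha> \<noteq> 0 \<or> \<beta> \<noteq> 0"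
      and eig: "\<And>x. x \<in> N \<Longrightarrow> \<beta> * cdot x (A *v y) = \<alpha> * cdot x (B *v y)"
      using pencil_eigenvector[OF A B N W \<open>W \<subset> N\<close> radA radB] by metis
    define W' where "W' = vec.span (insert y W)"
    have W': "vec.subspace W'"
      by (simp add: W'_def)
    have W'D: "\<exists>k w. w \<in> W \<and> v = k *s y + w" if v: "v \<in> W'" for v
    proof -
      obtain k where "v - k *s y \<in> vec.span W"
        using v vec.span_breakdown_eq[of v y W] by (auto simp: W'_def)
      then have "v - k *s y \<in> W"
        using vec.span_eq_iff W by metis
      then show ?thesis
        by (intro exI[of _ k] exI[of _ "v - k *s y"]) simp
    qed
    have W'I: "y \<in> W'" "W \<subseteq> W'"
      by (auto simp: W'_def intro: vec.span_base)
    have dimW': "vec.dim W' = Suc (vec.dim W)"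
      using y(2) W unfolding W'_def by (simp add: vec.dim_insert vec.span_eq_iff[THEN iffD2])
    have dimN: "vec.dim W < vec.dim N"
      using \<open>W \<subset> N\<close> vec.dim_psubset[of W N] N W by (simp add: vec.span_eq_iff[THEN iffD2])
    have W'N: "W' \<subseteq> N"
      unfolding W'_def using y WN N by (intro vec.span_minimal) auto
    have rad': "cdot x (M *v v) = 0"
      if M: "\<And>w. w \<in> W \<Longrightarrow> cdot x (M *v w) = 0" "cdot x (M *v y) = 0" and v: "v \<in> W'"
      for x v and M :: "complex^'n^'n"
      using W'D[OF v] M by (auto simp: vec.add vec.scale cdot_simps)
    define a b where "a = cdot y (A *v y)" and "b = cdot y (B *v y)"
    have real: "cnj a = a" "cnj b = b"
      unfolding a_def b_def
      using cdot_hermitian[OF A, of y y] cnj_cdot[of y "A *v y"]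
        cdot_hermitian[OF B, of y y] cnj_cdot[of y "B *v y"] by simp_all
    have Ra: "of_real (Re a) = a" "of_real (Re b) = b"
      using real by (metis Reals_cnj_iff of_real_Re)+
    have ab: "\<beta> * a = \<alpha> * b"
      using eig[OF y(1)] by (simp add: a_def b_def)
    (* u represents the functional to which A y and B y are proportional on N, scaled to 1 at y *)
    have step: "hermitian_sum_on A B N (vec.dim N - vec.dim W)"
      if uy: "cdot u y = 1"
        and uA: "\<And>x. x \<in> N \<Longrightarrow> cdot x (A *v y) = a * cdot x u"
        and uB: "\<And>x. x \<in> N \<Longrightarrow> cdot x (B *v y) = b * cdot x u" for u
    proof -
      have uW: "cdot u w = 0" if "w \<in> W" "c \<noteq> 0" "hermitian M" "cdot w (M *v y) = c * cdot w u"
          "cdot y (M *v w) = 0" for w c M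
      proof -
        have "cdot w (M *v y) = 0"
          using cdot_hermitian[OF that(3), of w y] cnj_cdot[of y "M *v w"] that(5) by simp
        with that show ?thesis
          using cnj_cdot[of w u] by simp
      qed
      let ?A = "A - Re a *\<^sub>R rank1 u u" and ?B = "B - Re b *\<^sub>R rank1 u u"
      have radW: "c * (cdot u w * cdot x u) = 0"
        if "w \<in> W" "x \<in> N" "c = a \<or> c = b" for w x c
      proof (cases "c = 0")
        case False
        from that(3) have "cdot u w = 0"
        proof
          assume "c = a"
          then show ?thesis
            using uW[OF that(1), of a A] False A uA radA y that(1) WN by blast
        next
          assume "c = b"
          then show ?thesis
            using uW[OF that(1), of b B] False B uB radB y that(1) WN by blast
        qed
        then show ?thesis by simp
      qed simp
      have "hermitian_sum_on ?A ?B N (vec.dim N - vec.dim W')"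
      proof (rule less.hyps)
        show "vec.dim N - vec.dim W' < vec.dim N - vec.dim W"
          using dimN dimW' by simp
        fix x v assume x: "x \<in> N" and v: "v \<in> W'"
        show "cdot x (?A *v v) = 0"
          by (rule rad'[OF _ _ v])
            (use x radW[OF _ x] radA uA uy in \<open>simp_all add: matrix_vector_mult_diff_rdistrib
              scaleR_matrix_mult rank1_mult cdot_simps Ra mult.assoc\<close>)
        show "cdot x (?B *v v) = 0"
          by (rule rad'[OF _ _ v])
            (use x radW[OF _ x] radB uB uy in \<open>simp_all add: matrix_vector_mult_diff_rdistrib
              scaleR_matrix_mult rank1_mult cdot_simps Ra mult.assoc\<close>)
      qed (use A B N W' W'N in \<open>auto intro: hermitian_diff hermitian_square\<close>)
      then have "hermitian_sum_on A B N (Suc (vec.dim N - vec.dim W'))"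
        by (rule hermitian_sum_on_square)
      then show ?thesis
        by (rule hermitian_sum_on_mono) (use dimN dimW' in simp)
    qed
    consider "a \<noteq> 0" | "a = 0" "b \<noteq> 0" | "a = 0" "b = 0" by blast
    then show ?thesis
    proof cases
      case 1
      show ?thesis
      proof (rule step[of "inverse a *s (A *v y)"])
        have "\<alpha> \<noteq> 0"
          using 1 ab \<alpha>\<beta> by auto
        fix x assume x: "x \<in> N"
        have "cdot x (B *v y) = \<beta> / \<alpha> * cdot x (A *v y)"
          using eig[OF x] \<open>\<alpha> \<noteq> 0\<close> by (simp add: field_simps)
        also have "\<beta> / \<alpha> = b / a"
          using ab \<open>\<alpha> \<noteq> 0\<close> 1 by (simp add: field_simps)
        finally show "cdot x (B *v y) = b * cdot x (inverse a *s (A *v y))"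
          by (simp add: cdot_simps field_simps)
      qed (use 1 real in \<open>simp_all add: cdot_simps cdot_hermitian[OF A] flip: a_def\<close>)
    next
      case 2
      show ?thesis
      proof (rule step[of "inverse b *s (B *v y)"])
        have "\<alpha> = 0"
          using 2 ab by simp
        fix x assume x: "x \<in> N"
        show "cdot x (A *v y) = a * cdot x (inverse b *s (B *v y))"
          using eig[OF x] \<open>\<alpha> = 0\<close> \<alpha>\<beta> 2 by simp
      qed (use 2 real in \<open>simp_all add: cdot_simps cdot_hermitian[OF B] flip: b_def\<close>)
    next
      case 3
      (* whichever of A y and B y has the other as a multiple on N *)
      define z where "z = (if \<alpha> = 0 then B *v y else A *v y)"
      have zA: "cdot x (A *v y) = 0" and zB: "cdot x (B *v y) = 0" if "x \<in> N" "cdot z x = 0" for x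
      proof -
        have "cdot x z = 0"
          using that(2) cnj_cdot[of z x] by simp
        then show "cdot x (A *v y) = 0" "cdot x (B *v y) = 0"
          using eig[OF that(1)] \<alpha>\<beta> by (auto simp: z_def split: if_splits)
      qed
      define N' where "N' = N \<inter> {x. cdot z x = 0}"
      have N': "vec.subspace N'"
        unfolding N'_def by (simp add: vec.subspace_inter N subspace_hyperplane)
      have zW': "cdot z v = 0" if "v \<in> W'" for v
      proof -
        have "cdot y (M *v v) = 0" if M: "M = A \<or> M = B" for M
          by (rule rad'[OF _ _ \<open>v \<in> W'\<close>]) (use M 3 y radA radB in \<open>auto simp: a_def b_def\<close>)
        then show ?thesis
          by (simp add: z_def cdot_hermitian[OF A] cdot_hermitian[OF B])
      qed
      have "W' \<subseteq> N'"
        using W'N zW' by (auto simp: N'_def)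
      then have dims: "Suc (vec.dim W) \<le> vec.dim N'"
        using vec.dim_subset dimW' by metis
      have "N' \<subseteq> N"
        by (simp add: N'_def)
      then have dimN': "vec.dim N' \<le> vec.dim N"
        by (rule vec.dim_subset)
      have red: "hermitian_sum_on A B N' (vec.dim N' - vec.dim W')"
      proof (rule less.hyps)
        show "vec.dim N' - vec.dim W' < vec.dim N - vec.dim W"
          using dimN' dims dimW' dimN by simp
        fix x v assume x: "x \<in> N'" and v: "v \<in> W'"
        show "cdot x (A *v v) = 0"
          by (rule rad'[OF _ _ v]) (use x zA radA in \<open>auto simp: N'_def\<close>)
        show "cdot x (B *v v) = 0"
          by (rule rad'[OF _ _ v]) (use x zB radB in \<open>auto simp: N'_def\<close>)
      qed (use A B N' W' \<open>W' \<subseteq> N'\<close> in auto)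
      show ?thesis
      proof (cases "N' = N")
        case True
        then show ?thesis
          using red dimW' by (auto intro: hermitian_sum_on_mono)
      next
        case False
        then have "vec.dim N' < vec.dim N"
          using \<open>N' \<subseteq> N\<close> vec.dim_psubset[of N' N] N N' by (simp add: vec.span_eq_iff[THEN iffD2] psubset_eq)
        moreover have "hermitian_sum_on A B N (vec.dim N' - vec.dim W' + 2)"
          using red unfolding N'_def by (rule hermitian_sum_on_cross[OF N])
        ultimately show ?thesis
          using dims dimW' by (auto intro: hermitian_sum_on_mono)
      qed
    qed
  qed
qed


section \<open>Column rank over an arbitrary field\<close>

abbreviation column_rank :: "'a::field^'n^'m \<Rightarrow> nat" where
  "column_rank M \<equiv> vec.dim (range ((*v) M))"

lemma subspace_range: "vec.subspace (range ((*v) M))"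
  by (rule vec.subspace_image) (rule vec.subspace_UNIV)

text \<open>Rank-nullity on a subspace: a linear section \<open>g\<close> of \<open>M\<close> on \<open>S\<close> splits \<open>S\<close> into \<open>g (M S)\<close> and the kernel.\<close>
lemma dim_image_kernel:
  fixes M :: "'a::field^'n^'m"
  assumes S: "vec.subspace S"
  shows "vec.dim ((*v) M ` S) + vec.dim (S \<inter> {x. M *v x = 0}) = vec.dim S"
proof -
  obtain g where g: "range g \<subseteq> S" "Vector_Spaces.linear (*s) (*s) g"
    "\<And>v. v \<in> (*v) M ` S \<Longrightarrow> M *v g v = v"
    using vec.linear_exists_right_inverse_on[OF matrix_vector_mul_linear_gen S, of M] by blast
  interpret g: Vector_Spaces.linear "(*s)" "(*s)" g by (rule g(2))
  let ?I = "(*v) M ` S" and ?K = "S \<inter> {x. M *v x = 0}"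
  have I: "vec.subspace ?I"
    by (rule vec.subspace_image[OF S])
  have K: "vec.subspace ?K"
    using S by (auto simp: vec.subspace_def vec.add vec.scale)
  have gI: "vec.subspace (g ` ?I)"
    by (rule g.subspace_image[OF I])
  have "inj_on g (vec.span ?I)"
    using I g(3) by (metis inj_on_inverseI vec.span_eq_iff)
  then have "vec.dim (g ` ?I) = vec.dim ?I"
    by (rule vec.dim_image_eq[OF g(2)])
  moreover have "z = 0" if "z \<in> g ` ?I" "M *v z = 0" for z
  proof -
    obtain v where v: "v \<in> ?I" "z = g v"
      using \<open>z \<in> g ` ?I\<close> by blast
    then have "v = 0"
      using g(3)[OF v(1)] \<open>M *v z = 0\<close> by simp
    then show ?thesis
      by (simp add: v(2) g.zero)
  qed
  then have "g ` ?I \<inter> ?K = {0}"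
    using vec.subspace_0[OF gI] vec.subspace_0[OF K] by blast
  moreover have "{x + y |x y. x \<in> g ` ?I \<and> y \<in> ?K} = S"
  proof safe
    fix x y assume "x \<in> S" "y \<in> S"
    then show "g (M *v x) + y \<in> S"
      using g(1) vec.subspace_add[OF S] by blast
  next
    fix x assume x: "x \<in> S"
    have "x - g (M *v x) \<in> ?K"
      using x g(1) vec.subspace_diff[OF S] g(3)[of "M *v x"] by (auto simp: vec.diff)
    then show "\<exists>a b. x = a + b \<and> a \<in> g ` ?I \<and> b \<in> ?K"
      using x by (intro exI[of _ "g (M *v x)"] exI[of _ "x - g (M *v x)"]) auto
  qed
  ultimately show ?thesis
    using vec.dim_sums_Int[OF gI K] by simp
qed

lemma column_rank_kernel: "column_rank (M :: 'a::field^'n^'m) + vec.dim {x. M *v x = 0} = CARD('n)"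
  using dim_image_kernel[OF vec.subspace_UNIV, of M] unfolding vec_dim_card by simp

lemma column_rank_add: "column_rank (P + Q) \<le> column_rank P + column_rank (Q :: 'a::field^'n^'m)"
proof -
  have "range ((*v) (P + Q)) \<subseteq> {x + y |x y. x \<in> range ((*v) P) \<and> y \<in> range ((*v) Q)}"
    by (auto simp: matrix_vector_mult_add_rdistrib)
  then have "column_rank (P + Q) \<le> vec.dim {x + y |x y. x \<in> range ((*v) P) \<and> y \<in> range ((*v) Q)}"
    by (rule vec.dim_subset)
  also have "\<dots> \<le> column_rank P + column_rank Q"
    using vec.dim_sums_Int[OF subspace_range subspace_range, of P Q] by linarith
  finally show ?thesis .
qed

lemma column_rank_mult: "column_rank (P ** Q) \<le> column_rank (P :: 'a::field^'n^'m)"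
  by (rule vec.dim_subset) (auto simp flip: matrix_vector_mul_assoc)

lemma column_rank_invertible:
  assumes "invertible (M :: 'a::field^'n^'n)"
  shows "column_rank M = CARD('n)"
proof -
  have "surj ((*v) M)"
    using assms matrix_right_invertible_surjective unfolding invertible_def by blast
  then show ?thesis
    by (simp only: vec_dim_card)
qed

text \<open>\<open>H\<close> is a generalized inverse, \<open>M H M = M\<close>, so \<open>1 - M H\<close> kills the range of \<open>M\<close>. Its use: replacing
  \<open>M\<close> by \<open>M'\<close> in the last term of \<open>1 = (1 - M H) + M H\<close> shows \<open>rank M' \<ge> rank M\<close> as soon as the new sum is
  still invertible.\<close>
lemma complementary_right_inverse:
  fixes M :: "'a::field^'n^'n"
  obtains H where "column_rank (mat 1 - M ** H) + column_rank M \<le> CARD('n)"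
proof -
  obtain g where g: "Vector_Spaces.linear (*s) (*s) g" "\<And>v. v \<in> range ((*v) M) \<Longrightarrow> M *v g v = v"
    using vec.linear_exists_right_inverse_on[OF matrix_vector_mul_linear_gen vec.subspace_UNIV, of M] by blast
  let ?Y = "mat 1 - M ** matrix g"
  have "?Y *v v = 0" if "v \<in> range ((*v) M)" for v
    using g(2)[OF that]
    by (simp add: matrix_vector_mult_diff_rdistrib matrix_works[OF g(1)] flip: matrix_vector_mul_assoc)
  then have "column_rank M \<le> vec.dim {x. ?Y *v x = 0}"
    by (intro vec.dim_subset) auto
  then show thesis
    using that[of "matrix g"] column_rank_kernel[of ?Y] by linarith
qed

lemma of_real_vector_mult: "of_real t *s (v :: complex^'n) = t *\<^sub>R v"
  by (simp add: vec_eq_iff) (simp add: scaleR_conv_of_real)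

text \<open>The matrix \<open>(1 - M H) + (M - t N) H = 1 - t N H\<close> is invertible when \<open>t\<close> is small.\<close>
lemma column_rank_lower_semicontinuous:
  fixes M N :: "complex^'n^'n"
  obtains t :: real where "t \<noteq> 0" "column_rank M \<le> column_rank (M - t *\<^sub>R N)"
proof -
  obtain H where H: "column_rank (mat 1 - M ** H) + column_rank M \<le> CARD('n)"
    by (rule complementary_right_inverse)
  define X where "X = N ** H"
  have "bounded_linear ((*v) X)"
  proof (intro linear_conv_bounded_linear[THEN iffD1] linearI)
    fix c :: real and v
    show "X *v (c *\<^sub>R v) = c *\<^sub>R (X *v v)"
      by (simp add: vec_eq_iff matrix_vector_mult_def scaleR_sum_right)
  qed (rule vec.add)
  then obtain K where K: "K > 0" "\<And>v. norm (X *v v) \<le> norm v * K"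
    using bounded_linear.pos_bounded by blast
  define t where "t = 1 / (2 * K)"
  have "v = 0" if "(mat 1 - t *\<^sub>R X) *v v = 0" for v
  proof -
    have "v = t *\<^sub>R (X *v v)"
      using that by (simp add: matrix_vector_mult_diff_rdistrib scaleR_matrix_mult of_real_vector_mult)
    then have "norm v = \<bar>t\<bar> * norm (X *v v)"
      by (metis norm_scaleR)
    also have "\<dots> \<le> \<bar>t\<bar> * (norm v * K)"
      by (intro mult_left_mono K) simp
    also have "\<dots> = norm v / 2"
      using K(1) by (simp add: t_def)
    finally show ?thesis by simp
  qed
  then have "invertible (mat 1 - t *\<^sub>R X)"
    unfolding invertible_left_inverse matrix_left_invertible_ker by blast
  then have "CARD('n) = column_rank (mat 1 - t *\<^sub>R X)"
    by (simp add: column_rank_invertible)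
  also have "mat 1 - t *\<^sub>R X = (mat 1 - M ** H) + (M - t *\<^sub>R N) ** H"
    by (simp add: X_def matrix_eq matrix_vector_mult_diff_rdistrib matrix_vector_mult_add_rdistrib
        scaleR_matrix_mult flip: matrix_vector_mul_assoc)
  also have "column_rank \<dots> \<le> column_rank (mat 1 - M ** H) + column_rank (M - t *\<^sub>R N)"
    using column_rank_add[of "mat 1 - M ** H" "(M - t *\<^sub>R N) ** H"] column_rank_mult[of "M - t *\<^sub>R N" H] by linarith
  finally have "column_rank M \<le> column_rank (M - t *\<^sub>R N)"
    using H by linarith
  moreover have "t \<noteq> 0"
    using K(1) by (simp add: t_def)
  ultimately show thesis
    using that by blast
qed

section \<open>The limit of the Wong sequence\<close>

text \<open>The union of the increasing sequence \<open>W\<^sub>0 = 0\<close>, \<open>W\<^sub>i\<^sub>+\<^sub>1 = A\<inverse>(B W\<^sub>i)\<close>. The inductive form turns the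
  usual arguments along the sequence into rule inductions.\<close>
inductive_set wong_limit :: "complex^'n^'n \<Rightarrow> complex^'n^'n \<Rightarrow> (complex^'n) set" for A B where
  zero: "0 \<in> wong_limit A B"
| step: "z \<in> wong_limit A B \<Longrightarrow> A *v x = B *v z \<Longrightarrow> x \<in> wong_limit A B"

lemma wong_limit_add: "x \<in> wong_limit A B \<Longrightarrow> x' \<in> wong_limit A B \<Longrightarrow> x + x' \<in> wong_limit A B"
proof (induction arbitrary: x' rule: wong_limit.induct)
  case (step z x)
  from step.prems show ?case
  proof cases
    case zero
    then show ?thesis
      using wong_limit.step step.hyps by simp
  next
    case (step z')
    then show ?thesis
      using wong_limit.step[of "z + z'" A B "x + x'"] step.IH \<open>A *v x = B *v z\<close>
      by (simp add: vec.add)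
  qed
qed simp

lemma wong_limit_scale: "x \<in> wong_limit A B \<Longrightarrow> c *s x \<in> wong_limit A B"
proof (induction rule: wong_limit.induct)
  case (step z x)
  then show ?case
    using wong_limit.step[of "c *s z" A B "c *s x"] by (simp add: vec.scale)
qed (simp add: wong_limit.zero)

lemma subspace_wong_limit: "vec.subspace (wong_limit A B)"
  by (simp add: vec.subspace_def wong_limit.zero wong_limit_add wong_limit_scale)

text \<open>From \<open>A x = B z\<close> and \<open>B z = (A - t B) y\<close> follows \<open>t B x = A x - (A - t B) x = (A - t B) (y - x)\<close>.\<close>
lemma wong_limit_in_perturbed_range:
  assumes "x \<in> wong_limit A B" and t: "t \<noteq> (0::real)"
  shows "B *v x \<in> range ((*v) (A - t *\<^sub>R B))"
  using assms(1)
proof (induction rule: wong_limit.induct)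
  case zero
  show ?case
    using vec.subspace_0[OF subspace_range] by simp
next
  case (step z x)
  then obtain y where y: "B *v z = (A - t *\<^sub>R B) *v y"
    by auto
  have "of_real t *s (B *v x) = A *v x - (A - t *\<^sub>R B) *v x"
    by (simp add: matrix_vector_mult_diff_rdistrib scaleR_matrix_mult)
  also have "\<dots> = (A - t *\<^sub>R B) *v (y - x)"
    using step.hyps(2) y by (simp add: vec.diff)
  finally have eq: "of_real t *s (B *v x) = (A - t *\<^sub>R B) *v (y - x)" .
  have "(A - t *\<^sub>R B) *v (inverse (of_real t) *s (y - x)) = B *v x"
    unfolding vec.scale eq[symmetric] using t by simp
  then have "B *v x = (A - t *\<^sub>R B) *v (inverse (of_real t) *s (y - x))"
    by simp
  then show ?case by blast
qed

text \<open>Suppose \<open>b = B x\<close> is outside the range of \<open>A\<close>. Then \<open>A\<close> has a kernel vector \<open>q\<close>, and \<open>A + b q\<^sup>*\<close> has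
  larger rank than \<open>A\<close>. Its rank cannot drop for a suitable small perturbation \<open>t B\<close>, but for \<open>t \<noteq> 0\<close> the vector \<open>b\<close>
  already lies in the range of \<open>A - t B\<close>, so that \<open>A - t B\<close> itself would have larger rank than \<open>A\<close>.\<close>
lemma wong_limit_in_range:
  fixes A B :: "complex^'n^'n"
  assumes max: "\<And>t::real. column_rank (A - t *\<^sub>R B) \<le> column_rank A" and x: "x \<in> wong_limit A B"
  shows "B *v x \<in> range ((*v) A)"
proof (rule ccontr)
  define b where "b = B *v x"
  assume "B *v x \<notin> range ((*v) A)"
  then have b: "b \<notin> range ((*v) A)"
    by (simp add: b_def)
  have "\<exists>q. A *v q = 0 \<and> q \<noteq> 0"
  proof (rule ccontr)
    assume "\<nexists>q. A *v q = 0 \<and> q \<noteq> 0"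
    then have "invertible A"
      unfolding invertible_left_inverse matrix_left_invertible_ker by blast
    then have "surj ((*v) A)"
      using matrix_right_invertible_surjective unfolding invertible_def by blast
    with b show False by blast
  qed
  then obtain q where q: "A *v q = 0" "q \<noteq> 0" by blast
  define A1 where "A1 = A + rank1 b q"
  have A1: "A1 *v y = A *v y + cdot q y *s b" for y
    by (simp add: A1_def matrix_vector_mult_add_rdistrib rank1_mult)
  have "b = A1 *v (inverse (cdot q q) *s q)"
    using q by (simp add: A1 vec.scale cdot_simps cdot_self_eq_0)
  then have bA1: "b \<in> range ((*v) A1)"
    by blast
  have "A *v y \<in> range ((*v) A1)" for y
  proof -
    have "A1 *v y - cdot q y *s b \<in> range ((*v) A1)"
      by (intro vec.subspace_diff[OF subspace_range] vec.subspace_scale[OF subspace_range] bA1 rangeI)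
    then show ?thesis
      by (simp add: A1)
  qed
  then have "vec.dim (insert b (range ((*v) A))) \<le> column_rank A1"
    using bA1 by (intro vec.dim_subset) auto
  then have "Suc (column_rank A) \<le> column_rank A1"
    using b by (simp add: vec.dim_insert vec.span_eq_iff[THEN iffD2, OF subspace_range])
  moreover obtain t :: real where t: "t \<noteq> 0" "column_rank A1 \<le> column_rank (A1 - t *\<^sub>R B)"
    by (rule column_rank_lower_semicontinuous)
  moreover have "column_rank (A1 - t *\<^sub>R B) \<le> column_rank (A - t *\<^sub>R B)"
  proof (rule vec.dim_subset, safe)
    fix y
    have "(A1 - t *\<^sub>R B) *v y = (A - t *\<^sub>R B) *v y + cdot q y *s b"
      by (simp add: A1 matrix_vector_mult_diff_rdistrib)
    moreover have "b \<in> range ((*v) (A - t *\<^sub>R B))"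
      unfolding b_def by (rule wong_limit_in_perturbed_range[OF x t(1)])
    ultimately show "(A1 - t *\<^sub>R B) *v y \<in> range ((*v) (A - t *\<^sub>R B))"
      by (simp only:) (intro vec.subspace_add[OF subspace_range] vec.subspace_scale[OF subspace_range] rangeI)
  qed
  ultimately show False
    using max[of t] by linarith
qed

text \<open>For \<open>W\<close> the Wong limit and \<open>U = A W\<close>, the radical of the pencil on \<open>N = U\<^sup>\<bottom>\<close> contains \<open>W\<close>. Hence weight
  \<open>dim N - dim W\<close> suffices on \<open>N\<close>, and cutting down from the whole space to \<open>N\<close> takes \<open>dim U\<close>
  hyperplanes of weight two each.\<close>
lemma hermitian_sum_column_rank:
  fixes A B :: "complex^'n^'n"
  assumes A: "hermitian A" and B: "hermitian B"
    and max: "\<And>t::real. column_rank (A - t *\<^sub>R B) \<le> column_rank A"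
  shows "hermitian_sum A B (column_rank A)"
proof -
  define W where "W = wong_limit A B"
  have W: "vec.subspace W"
    by (simp add: W_def subspace_wong_limit)
  have next_W: "\<exists>x'\<in>W. B *v x = A *v x'" if x: "x \<in> W" for x
  proof -
    obtain x' where "B *v x = A *v x'"
      using wong_limit_in_range[OF max] x unfolding W_def by blast
    then show ?thesis
      using wong_limit.step[of x A B x'] x by (auto simp: W_def)
  qed
  (* <x, A x'> moves one step down the chain of x and one step up that of x', until x is 0 *)
  have isoA: "cdot x (A *v x') = 0" if "x \<in> W" "x' \<in> W" for x x'
    using that unfolding W_def
  proof (induction arbitrary: x' rule: wong_limit.induct)
    case (step z x)
    obtain x'' where x'': "x'' \<in> W" "B *v x' = A *v x''"
      using next_W step.prems unfolding W_def by blast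
    have "cdot x (A *v x') = cdot (B *v z) x'"
      by (simp add: cdot_hermitian[OF A, symmetric] step.hyps)
    also have "\<dots> = cdot z (A *v x'')"
      by (simp add: cdot_hermitian[OF B] x'')
    finally show ?case
      using step.IH x''(1) by (simp add: W_def)
  qed simp
  define U where "U = (*v) A ` W"
  have U: "vec.subspace U"
    unfolding U_def by (rule vec.subspace_image[OF W])
  have BU: "B *v x \<in> U" if "x \<in> W" for x
    using next_W[OF that] by (auto simp: U_def)
  define N where "N = {x. \<forall>u\<in>U. cdot u x = 0}"
  have N: "vec.subspace N"
    by (simp add: N_def subspace_perp)
  have perp: "cdot x u = 0" if "x \<in> N" "u \<in> U" for x u
    using that cnj_cdot[of u x] by (simp add: N_def)
  have WN: "W \<subseteq> N"
  proof safe
    fix x assume x: "x \<in> W"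
    show "x \<in> N"
      unfolding N_def U_def
    proof safe
      fix w assume w: "w \<in> W"
      show "cdot (A *v w) x = 0"
        using isoA[OF x w] cnj_cdot[of x "A *v w"] by simp
    qed
  qed
  have "hermitian_sum_on A B N (vec.dim N - vec.dim W)"
    by (rule hermitian_sum_on_mod_radical[OF A B N W WN]) (auto intro: perp BU simp: U_def)
  moreover obtain Z where Z: "Z \<subseteq> U" "vec.independent Z" "U \<subseteq> vec.span Z" "card Z = vec.dim U"
    using vec.basis_exists .
  have "N = UNIV \<inter> {x. \<forall>z\<in>Z. cdot z x = 0}"
  proof -
    have "cdot u x = 0" if z: "\<forall>z\<in>Z. cdot z x = 0" and u: "u \<in> U" for x u
    proof -
      have "Z \<subseteq> {u. \<forall>v\<in>{x}. cdot v u = 0}"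
      proof
        fix v assume "v \<in> Z"
        then show "v \<in> {u. \<forall>v\<in>{x}. cdot v u = 0}"
          using z cnj_cdot[of v x] by simp
      qed
      then have "vec.span Z \<subseteq> {u. \<forall>v\<in>{x}. cdot v u = 0}"
        by (rule vec.span_minimal) (rule subspace_perp)
      then have "cdot x u = 0"
        using u Z(3) by auto
      then show ?thesis
        using cnj_cdot[of x u] by simp
    qed
    then show ?thesis
      using Z(1) by (auto simp: N_def)
  qed
  ultimately have "hermitian_sum_on A B UNIV (vec.dim N - vec.dim W + 2 * vec.dim U)"
    using hermitian_sum_on_perp[of Z UNIV A B] Z(2,4) by (simp add: vec.finiteI_independent)
  moreover have "vec.dim N - vec.dim W + 2 * vec.dim U \<le> column_rank A"
  proof -
    have "N \<inter> U = {0}"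
      using perp vec.subspace_0[OF N] vec.subspace_0[OF U] by (auto simp flip: cdot_self_eq_0)
    then have "vec.dim N + vec.dim U \<le> CARD('n)"
      using vec.dim_sums_Int[OF N U] vec.dim_subset[OF subset_UNIV, of "{x + y |x y. x \<in> N \<and> y \<in> U}"]
      unfolding vec_dim_card by simp
    moreover have "{x. A *v x = 0} \<subseteq> W"
      using wong_limit.step[OF wong_limit.zero, of A _ B] by (auto simp: W_def)
    then have "vec.dim U + vec.dim {x. A *v x = 0} = vec.dim W"
      using dim_image_kernel[OF W, of A] by (simp add: U_def Int_absorb1)
    moreover have "vec.dim W \<le> vec.dim N"
      by (rule vec.dim_subset[OF WN])
    ultimately show ?thesis
      using column_rank_kernel[of A] by linarith
  qed
  ultimately have "hermitian_sum_on A B UNIV (column_rank A)"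
    by (rule hermitian_sum_on_mono)
  then obtain A' B' where AB': "vanishes_on A' UNIV" "vanishes_on B' UNIV" "hermitian_sum (A - A') (B - B') (column_rank A)"
    unfolding hermitian_sum_on_def by blast
  have "F = 0" if "vanishes_on F UNIV" for F :: "complex^'n^'n"
    using that cdot_self_eq_0 by (auto simp: vanishes_on_def matrix_eq)
  then have "A' = 0" "B' = 0"
    using AB' by blast+
  with AB'(3) show ?thesis
    by simp
qed


section \<open>Specialization of a polynomial matrix\<close>

text \<open>Row rank bounds column rank: expanding the rows in a basis of \<open>r\<close> of them factors \<open>M\<close> through dimension \<open>r\<close>.\<close>
lemma column_rank_le_rank: "column_rank (M :: 'a::field^'n^'m) \<le> rank M"
proof -
  obtain S where S: "S \<subseteq> rows M" "vec.independent S" "rows M \<subseteq> vec.span S" "card S = rank M"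
    unfolding row_rank_def_gen using vec.basis_exists .
  have finS: "finite S"
    using S(2) by (rule vec.finiteI_independent)
  have "\<exists>u. row i M = (\<Sum>v\<in>S. u v *s v)" for i
    using S(3) unfolding vec.span_finite[OF finS] rows_def by blast
  then obtain c where c: "\<And>i. row i M = (\<Sum>v\<in>S. c i v *s v)"
    by metis
  have entry: "M $ i $ j = (\<Sum>v\<in>S. c i v * v $ j)" for i j
    using arg_cong[OF c[of i], of "\<lambda>v. v $ j"] by (simp add: row_def)
  have "M *v x = (\<Sum>v\<in>S. (\<Sum>j\<in>UNIV. v $ j * x $ j) *s (\<chi> i. c i v))" for x
  proof -
    have "(M *v x) $ i = (\<Sum>j\<in>UNIV. \<Sum>v\<in>S. c i v * v $ j * x $ j)" for i
      by (simp add: matrix_vector_mult_def entry sum_distrib_right)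
    also have "\<dots> i = (\<Sum>v\<in>S. \<Sum>j\<in>UNIV. c i v * v $ j * x $ j)" for i
      by (rule sum.swap)
    finally show ?thesis
      by (simp add: vec_eq_iff sum_distrib_left algebra_simps)
  qed
  moreover have "(\<Sum>v\<in>S. (\<Sum>j\<in>UNIV. v $ j * x $ j) *s (\<chi> i. c i v)) \<in> vec.span ((\<lambda>v. \<chi> i. c i v) ` S)" for x
    by (intro vec.span_sum vec.span_scale vec.span_base imageI)
  ultimately have "range ((*v) M) \<subseteq> vec.span ((\<lambda>v. \<chi> i. c i v) ` S)"
    by auto
  then have "column_rank M \<le> card ((\<lambda>v. \<chi> i. c i v) ` S)"
    by (rule vec.dim_le_card) (simp add: finS)
  also have "\<dots> \<le> rank M"
    using card_image_le[OF finS] S(4) by metis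
  finally show ?thesis .
qed

abbreviation const_matrix :: "complex^'n^'m \<Rightarrow> complex poly^'n^'m" where
  "const_matrix \<equiv> map_matrix (\<lambda>c. [:c:])"

abbreviation frac_matrix :: "complex poly^'n^'m \<Rightarrow> complex poly fract^'n^'m" where
  "frac_matrix \<equiv> map_matrix to_fract"

lemma to_fract_sum: "to_fract (sum f S) = (\<Sum>x\<in>S. to_fract (f x))"
  by (induction S rule: infinite_finite_induct) simp_all

lemma const_poly_sum: "[:sum f S :: complex:] = (\<Sum>x\<in>S. [:f x:])"
  by (simp add: poly_eq_iff coeff_sum coeff_pCons split: nat.splits)

lemma to_fract_prod: "to_fract (prod f S) = (\<Prod>x\<in>S. to_fract (f x))"
  by (induction S rule: infinite_finite_induct) simp_all

lemma to_fract_of_int: "to_fract (of_int k) = of_int k"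
proof -
  have "to_fract (of_nat m) = of_nat m" for m
    by (induction m) simp_all
  then show ?thesis
    by (cases k rule: int_cases2) simp_all
qed

lemma det_frac_matrix: "det (frac_matrix M) = to_fract (det M)"
  unfolding det_def by (simp add: to_fract_sum to_fract_prod to_fract_of_int)

lemma det_eval_matrix: "det (map_matrix (\<lambda>p. poly p c) M) = poly (det M) c"
  unfolding det_def by (simp add: poly_sum poly_prod)

lemma frac_matrix_mult: "frac_matrix (M ** N) = frac_matrix M ** frac_matrix N"
  by (simp add: vec_eq_iff matrix_matrix_mult_def to_fract_sum)

lemma frac_matrix_add: "frac_matrix (M + N) = frac_matrix M + frac_matrix N"
  by (simp add: vec_eq_iff)

lemma column_rank_const_matrix:
  fixes M :: "complex^'n^'m"
  shows "column_rank (frac_matrix (const_matrix M)) \<le> column_rank M"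
proof -
  define \<iota> where "\<iota> v = (\<chi> i. to_fract [:v $ i:])" for v :: "complex^'m"
  obtain S where S: "S \<subseteq> range ((*v) M)" "vec.independent S" "range ((*v) M) \<subseteq> vec.span S"
      "card S = column_rank M"
    using vec.basis_exists .
  have finS: "finite S"
    using S(2) by (rule vec.finiteI_independent)
  have col: "\<iota> (column j M) \<in> vec.span (\<iota> ` S)" for j
  proof -
    have "column j M = M *v axis j 1"
      by (simp add: matrix_vector_mult_def column_def vec_eq_iff axis_def if_distrib sum.delta cong: if_cong)
    then have "column j M \<in> vec.span S"
      using S(3) by auto
    then obtain u where "column j M = (\<Sum>v\<in>S. u v *s v)"
      unfolding vec.span_finite[OF finS] by blast
    then have "\<iota> (column j M) = (\<Sum>v\<in>S. to_fract [:u v:] *s \<iota> v)"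
      by (simp add: \<iota>_def vec_eq_iff const_poly_sum to_fract_sum mult.commute flip: to_fract_mult)
    then show ?thesis
      by (simp add: vec.span_sum vec.span_scale vec.span_base)
  qed
  have "column j (frac_matrix (const_matrix M)) = \<iota> (column j M)" for j
    by (simp add: column_def \<iota>_def vec_eq_iff)
  then have "frac_matrix (const_matrix M) *v x \<in> vec.span (\<iota> ` S)" for x
    using col by (simp add: matrix_mult_sum vec.span_sum vec.span_scale)
  then have "column_rank (frac_matrix (const_matrix M)) \<le> card (\<iota> ` S)"
    by (intro vec.dim_le_card) (use finS in auto)
  also have "\<dots> \<le> column_rank M"
    using card_image_le[OF finS] S(4) by metis
  finally show ?thesis .
qed

text \<open>With a generalized inverse \<open>H\<close> of \<open>M = E(c)\<close>, the polynomial matrix \<open>(1 - M H) + E H\<close> is the identity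
  at \<open>c\<close>. Its determinant is therefore a nonzero polynomial, so the matrix is invertible over the
  rational functions, and \<open>n \<le> (n - rank M) + rank E\<close>.\<close>
lemma column_rank_eval_le_normal_rank:
  fixes E :: "complex poly^'n^'n"
  shows "column_rank (map_matrix (\<lambda>p. poly p c) E) \<le> normal_rank E"
proof -
  define M where "M = map_matrix (\<lambda>p. poly p c) E"
  obtain H where H: "column_rank (mat 1 - M ** H) + column_rank M \<le> CARD('n)"
    by (rule complementary_right_inverse)
  define Y where "Y = mat 1 - M ** H"
  define D where "D = const_matrix Y + E ** const_matrix H"
  have "map_matrix (\<lambda>p. poly p c) D = Y + M ** H"
    by (simp add: D_def M_def vec_eq_iff matrix_matrix_mult_def poly_sum mult.commute)
  also have "\<dots> = mat 1"
    by (simp add: Y_def)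
  finally have "poly (det D) c = 1"
    using det_eval_matrix[of c D] by simp
  then have "det D \<noteq> 0"
    by auto
  then have "invertible (frac_matrix D)"
    by (simp add: invertible_det_nz det_frac_matrix)
  then have "CARD('n) = column_rank (frac_matrix D)"
    by (simp add: column_rank_invertible)
  also have "\<dots> \<le> column_rank (frac_matrix (const_matrix Y)) + column_rank (frac_matrix E ** frac_matrix (const_matrix H))"
    unfolding D_def frac_matrix_add frac_matrix_mult by (rule column_rank_add)
  also have "\<dots> \<le> column_rank Y + rank (frac_matrix E)"
    by (intro add_mono column_rank_const_matrix order.trans[OF column_rank_mult column_rank_le_rank])
  finally show ?thesis
    using H unfolding normal_rank_def Y_def M_def by linarith
qed

section \<open>Decomposition of a Hermitian pencil\<close>

text \<open>The substitution \<open>\<lambda> \<mapsto> \<lambda> - t\<close> preserves the shape of each term because \<open>t\<close> is real.\<close>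
lemma hermitian_sum_shift: "hermitian_sum A B m \<Longrightarrow> hermitian_sum (A - t *\<^sub>R B) B m"
proof (induction rule: hermitian_sum.induct)
  case (square A B m a u b)
  have "hermitian_sum (A - t *\<^sub>R B + (a - t * b) *\<^sub>R rank1 u u) (B + b *\<^sub>R rank1 u u) (Suc m)"
    by (rule hermitian_sum.square[OF square.IH])
  then show ?case
    by (simp add: algebra_simps)
next
  case (cross A B m v w w')
  have "hermitian_sum (A - t *\<^sub>R B + (rank1 v (w - t *\<^sub>R w') + rank1 (w - t *\<^sub>R w') v))
      (B + (rank1 v w' + rank1 w' v)) (m + 2)"
    by (rule hermitian_sum.cross[OF cross.IH])
  also have "A - t *\<^sub>R B + (rank1 v (w - t *\<^sub>R w') + rank1 (w - t *\<^sub>R w') v) =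
      A + (rank1 v w + rank1 w v) - t *\<^sub>R (B + (rank1 v w' + rank1 w' v))"
    by (simp add: vec_eq_iff) (simp add: scaleR_conv_of_real algebra_simps)
  finally show ?case .
qed (simp add: hermitian_sum.zero)

lemma hermitian_sum_normal_rank:
  fixes A B :: "complex^'n^'n"
  assumes A: "hermitian A" and B: "hermitian B"
  shows "hermitian_sum A B (normal_rank (pencil A B))"
proof -
  have "column_rank (A - t *\<^sub>R B) \<le> CARD('n)" for t :: real
    using column_rank_kernel[of "A - t *\<^sub>R B"] by linarith
  then obtain t0 :: real where t0: "\<And>t. column_rank (A - t *\<^sub>R B) \<le> column_rank (A - t0 *\<^sub>R B)"
    using ex_has_greatest_nat[of "\<lambda>_. True" 0 "\<lambda>t::real. column_rank (A - t *\<^sub>R B)" "Suc CARD('n)"]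
    by (auto simp: less_Suc_eq_le)
  define A0 where "A0 = A - t0 *\<^sub>R B"
  have "hermitian_sum A0 B (column_rank A0)"
  proof (rule hermitian_sum_column_rank)
    show "hermitian A0"
      unfolding A0_def by (intro hermitian_diff hermitian_scaleR A B)
    show "column_rank (A0 - t *\<^sub>R B) \<le> column_rank A0" for t :: real
      using t0[of "t0 + t"] by (simp add: A0_def algebra_simps)
  qed (rule B)
  then have "hermitian_sum (A0 - (- t0) *\<^sub>R B) B (column_rank A0)"
    by (rule hermitian_sum_shift)
  then have "hermitian_sum A B (column_rank A0)"
    by (simp add: A0_def)
  moreover have "A0 = map_matrix (\<lambda>p. poly p (- of_real t0)) (pencil A B)"
    by (simp add: A0_def pencil_def vec_eq_iff) (simp add: scaleR_conv_of_real algebra_simps)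
  then have "column_rank A0 \<le> normal_rank (pencil A B)"
    using column_rank_eval_le_normal_rank by metis
  ultimately show ?thesis
    by (rule hermitian_sum_mono)
qed

definition linear_vec :: "complex^'n \<Rightarrow> complex^'n \<Rightarrow> complex poly^'n" where
  "linear_vec x y = (\<chi> i. [:x $ i, y $ i:])"

lemma vec_degree_le: "(\<And>i. degree (v $ i) \<le> d) \<Longrightarrow> vec_degree v \<le> d"
  unfolding vec_degree_def by (subst Max_le_iff) auto

lemma vec_degree_linear_vec: "vec_degree (linear_vec x 0) = 0" "vec_degree (linear_vec x y) \<le> 1"
proof -
  have "vec_degree (linear_vec x 0) \<le> 0"
    by (rule vec_degree_le) (simp add: linear_vec_def)
  then show "vec_degree (linear_vec x 0) = 0" by simp
qed (rule vec_degree_le, simp add: linear_vec_def)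

lemma map_poly_cnj: "map_poly cnj [:a, b:] = [:cnj a, cnj b:]" "map_poly cnj [:a:] = [:cnj a:]"
  by (simp_all add: map_poly_pCons)

lemma pencil_square:
  "pencil (A + a *\<^sub>R rank1 u u) (B + b *\<^sub>R rank1 u u) = pencil A B +
    matrix_scale [:of_real a, of_real b:] (outer_prod (linear_vec u 0) (vec_star (linear_vec u 0)))"
  by (simp add: vec_eq_iff pencil_def matrix_scale_def outer_prod_def vec_star_def linear_vec_def
      map_poly_cnj) (simp add: scaleR_conv_of_real mult.assoc)

lemma pencil_cross:
  "pencil (A + (rank1 v w + rank1 w v)) (B + (rank1 v w' + rank1 w' v)) = pencil A B +
    (outer_prod (linear_vec v 0) (vec_star (linear_vec w w')) + outer_prod (linear_vec w w') (vec_star (linear_vec v 0)))"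
  by (simp add: vec_eq_iff pencil_def outer_prod_def vec_star_def linear_vec_def map_poly_cnj mult.commute)

lemma pencil_of_hermitian_sum:
  fixes A B :: "complex^'n^'n"
  assumes "hermitian_sum A B r"
  shows "\<exists>(l::nat) (s::nat) (a::nat \<Rightarrow> real) (b::nat \<Rightarrow> real)
      (u::nat \<Rightarrow> complex poly^'n) (v::nat \<Rightarrow> complex poly^'n) (w::nat \<Rightarrow> complex poly^'n).
    pencil A B =
      (\<Sum>i<l. matrix_scale [:complex_of_real (a i), complex_of_real (b i):]
                (outer_prod (u i) (vec_star (u i))))
      + (\<Sum>j<s. outer_prod (v j) (vec_star (w j)))
      + (\<Sum>j<s. outer_prod (w j) (vec_star (v j))) \<and>
    l + 2 * s = r \<and>
    (\<forall>i<l. vec_degree (u i) = 0) \<and>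
    (\<forall>j<s. vec_degree (v j) = 0) \<and>
    (\<forall>j<s. vec_degree (w j) \<le> 1)"
  using assms
proof (induction rule: hermitian_sum.induct)
  case zero
  have "pencil 0 0 = (0 :: complex poly^'n^'n)"
    by (simp add: pencil_def vec_eq_iff)
  then show ?case
    by (intro exI[of _ 0] exI) auto
next
  case (square A B m a0 u0 b0)
  then obtain l s a b u v w where IH: "pencil A B =
      (\<Sum>i<l. matrix_scale [:complex_of_real (a i), complex_of_real (b i):]
                (outer_prod (u i) (vec_star (u i))))
      + (\<Sum>j<s. outer_prod (v j) (vec_star (w j)))
      + (\<Sum>j<s. outer_prod (w j) (vec_star (v j)))" "l + 2 * s = m"
    "\<forall>i<l. vec_degree (u i) = 0" "\<forall>j<s. vec_degree (v j) = 0" "\<forall>j<s. vec_degree (w j) \<le> 1"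
    by blast
  show ?case
    by (rule exI[of _ "Suc l"], rule exI[of _ s], rule exI[of _ "a(l := a0)"],
        rule exI[of _ "b(l := b0)"], rule exI[of _ "u(l := linear_vec u0 0)"],
        rule exI[of _ v], rule exI[of _ w], intro conjI)
      (use IH in \<open>simp_all add: pencil_square less_Suc_eq vec_degree_linear_vec\<close>)
next
  case (cross A B m v0 w0 w1)
  then obtain l s a b u v w where IH: "pencil A B =
      (\<Sum>i<l. matrix_scale [:complex_of_real (a i), complex_of_real (b i):]
                (outer_prod (u i) (vec_star (u i))))
      + (\<Sum>j<s. outer_prod (v j) (vec_star (w j)))
      + (\<Sum>j<s. outer_prod (w j) (vec_star (v j)))" "l + 2 * s = m"
    "\<forall>i<l. vec_degree (u i) = 0" "\<forall>j<s. vec_degree (v j) = 0" "\<forall>j<s. vec_degree (w j) \<le> 1"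
    by blast
  show ?case
    by (rule exI[of _ l], rule exI[of _ "Suc s"], rule exI[of _ a],
        rule exI[of _ b], rule exI[of _ u], rule exI[of _ "v(s := linear_vec v0 0)"],
        rule exI[of _ "w(s := linear_vec w0 w1)"], intro conjI)
      (use IH in \<open>simp_all add: pencil_cross less_Suc_eq vec_degree_linear_vec del: One_nat_def\<close>)
qed

theorem theorem2:
  fixes A B :: "complex^'n^'n" and r :: nat
  assumes "hermitian A" and "hermitian B"
    and "normal_rank (pencil A B) = r" and "r \<le> CARD('n)"
  shows "\<exists>(l::nat) (s::nat) (a::nat \<Rightarrow> real) (b::nat \<Rightarrow> real)
      (u::nat \<Rightarrow> complex poly^'n) (v::nat \<Rightarrow> complex poly^'n) (w::nat \<Rightarrow> complex poly^'n).
    pencil A B =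
      (\<Sum>i<l. matrix_scale [:complex_of_real (a i), complex_of_real (b i):]
                (outer_prod (u i) (vec_star (u i))))
      + (\<Sum>j<s. outer_prod (v j) (vec_star (w j)))
      + (\<Sum>j<s. outer_prod (w j) (vec_star (v j))) \<and>
    l + 2 * s = r \<and>
    (\<forall>i<l. vec_degree (u i) = 0) \<and>
    (\<forall>j<s. vec_degree (v j) = 0) \<and>
    (\<forall>j<s. vec_degree (w j) \<le> 1)"
  using pencil_of_hermitian_sum[OF hermitian_sum_normal_rank[OF assms(1,2)]]
  unfolding assms(3) .

end
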